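(* Let $p$ be a prime, $h\ge 0$ an integer, $1\le a\le p-1$, and $k=ap^h$. Assume that $p-1\mid n-a$ and $k\le n<kp$. Then $s(n,k)$ is a minimum zero case (MZC), $s(n-1,k-1)$ is a shifted minimum zero case (SMZC), and $$\nu_p(s(n,k))=\nu_p(s(n-1,k-1))=\frac{\sigma_p(k-1)-\sigma_p(n-1)}{p-1}.$$
   Context: $s(n,k)$ is the (unsigned) Stirling number of the first kind, defined by $x(x-1)\cdots(x-n+1)=\sum_{k=0}^n(-1)^{n-k}s(n,k)x^k$. $\sigma_p(m)$ is the sum of the base $p$ digits of $m\ge 0$; $\nu_p$ is the $p$-adic valuation. $s(n,k)$ is a minimum zero case (MZC) if $\nu_p(s(n,k))=(\sigma_p(k-1)-\sigma_p(n-1))/(p-1)$, and a shifted minimum zero case (SMZC) if $\nu_p(s(n,k))=(\sigma_p(k)-\sigma_p(n))/(p-1)$. *)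

theory Defs
  imports Complex_Main
    "HOL-Combinatorics.Stirling"
    "HOL-Computational_Algebra.Primes"
begin

text \<open>
  \<^const>\<open>stirling\<close> is the unsigned Stirling number of the first kind: its values are the
  coefficients, up to sign, of the falling factorial.
\<close>

lemma falling_factorial_eq_sum_stirling:
  fixes x :: "'a :: comm_ring_1"
  shows "(\<Prod>i<n. x - of_nat i) = (\<Sum>k\<le>n. (-1) ^ (n - k) * of_nat (stirling n k) * x ^ k)"
proof -
  have sgn: "(-1) ^ n * (-1) ^ k = ((-1) ^ (n - k) :: 'a)" if "k \<le> n" for k
  proof -
    have "n = (n - k) + k" using that by simp
    then have "(-1) ^ n = ((-1) ^ (n - k) * (-1) ^ k :: 'a)" by (metis power_add)
    then show ?thesis by (simp add: mult.assoc flip: power_mult_distrib)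
  qed
  have "(\<Prod>i<n. x - of_nat i) = (-1) ^ n * (\<Prod>i<n. - x + of_nat i)"
    by (induction n) (simp_all add: algebra_simps)
  also have "(\<Prod>i<n. - x + of_nat i) = pochhammer (- x) n"
    by (simp add: pochhammer_prod atLeast0LessThan)
  also have "\<dots> = (\<Sum>k\<le>n. of_nat (stirling n k) * (- x) ^ k)"
    by (rule stirling_pochhammer [symmetric])
  also have "(-1) ^ n * \<dots> = (\<Sum>k\<le>n. (-1) ^ (n - k) * of_nat (stirling n k) * x ^ k)"
    unfolding sum_distrib_left
  proof (rule sum.cong)
    fix k assume "k \<in> {..n}"
    then have "(-1) ^ n * (of_nat (stirling n k) * (- x) ^ k)
        = ((-1) ^ n * (-1) ^ k) * of_nat (stirling n k) * x ^ k"
      by (subst power_minus) (simp add: mult_ac)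
    with \<open>k \<in> {..n}\<close> show "(-1) ^ n * (of_nat (stirling n k) * (- x) ^ k)
        = (-1) ^ (n - k) * of_nat (stirling n k) * x ^ k"
      by (simp add: sgn)
  qed simp
  finally show ?thesis .
qed

text \<open>For \<open>p \<ge> 2\<close> all base \<open>p\<close> digits of \<open>m\<close> at positions beyond \<open>m\<close> vanish, as \<open>m < p ^ m\<close>.\<close>

definition digit_sum :: "nat \<Rightarrow> nat \<Rightarrow> nat" where
  "digit_sum p m = (\<Sum>i\<le>m. m div p ^ i mod p)"

text \<open>
  The \<open>p\<close>-adic valuation is \<^term>\<open>multiplicity p\<close>. Since \<open>multiplicity p 0 = 0\<close>, whereas the
  valuation of \<open>0\<close> is infinite, the number is explicitly required to be nonzero. The condition
  \<open>1 \<le> k\<close> (whence \<open>1 \<le> n\<close> for a nonzero number) rules out truncation in \<open>k - 1\<close> and \<open>n - 1\<close>.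
\<close>

definition minimum_zero_case :: "nat \<Rightarrow> nat \<Rightarrow> nat \<Rightarrow> bool" where
  "minimum_zero_case p n k \<longleftrightarrow> 1 \<le> k \<and> stirling n k \<noteq> 0 \<and>
     real (multiplicity p (stirling n k))
       = (real (digit_sum p (k - 1)) - real (digit_sum p (n - 1))) / (real p - 1)"

definition shifted_minimum_zero_case :: "nat \<Rightarrow> nat \<Rightarrow> nat \<Rightarrow> bool" where
  "shifted_minimum_zero_case p n k \<longleftrightarrow> stirling n k \<noteq> 0 \<and>
     real (multiplicity p (stirling n k))
       = (real (digit_sum p k) - real (digit_sum p n)) / (real p - 1)"

end

theory Submission
  imports Defs "HOL-Computational_Algebra.Formal_Power_Series"
begin

text \<open>
  Let \<open>g = - log (1 - x) / x = \<Sum>i. x ^ i / (i + 1)\<close>. Then \<open>K! s(N, K) / N!\<close> is the coefficient of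
  \<open>x ^ (N - K)\<close> in \<open>g ^ K\<close>, and \<open>K! s(N + 1, K + 1) / N!\<close> is the sum of the coefficients up to that one.
  The coefficient of \<open>x ^ j\<close> in \<open>g ^ K\<close> has valuation at least \<open>- j / (p - 1)\<close>, and for
  \<open>j = r (p - 1)\<close> it is \<open>p ^ (- r)\<close> times a number congruent to \<open>K choose r\<close> modulo \<open>p\<close>. For
  \<open>K = a p ^ h - 1\<close> and \<open>r \<le> K\<close> this binomial coefficient is prime to \<open>p\<close>, so the last coefficient
  has a strictly smaller valuation than all earlier ones and determines the valuation of both Stirling
  numbers; Legendre's formula turns it into digit sums.
\<close>

unbundle fps_syntax

text \<open>For prime \<open>p\<close> this is the localization of the integers at \<open>p\<close>,
  and \<open>p_divisible\<close> is its maximal ideal; congruences between rationals modulo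
  \<open>p\<close> are stated through these two predicates.\<close>

definition p_integral :: "nat \<Rightarrow> rat \<Rightarrow> bool" where
  "p_integral p x \<longleftrightarrow> (\<exists>b. \<not> p dvd b \<and> of_nat b * x \<in> \<int>)"

definition p_divisible :: "nat \<Rightarrow> rat \<Rightarrow> bool" where
  "p_divisible p x \<longleftrightarrow> p_integral p (x / of_nat p)"

section \<open>Stirling numbers as coefficients of powers of a logarithm\<close>

definition neg_log_quotient :: "rat fps" where
  "neg_log_quotient = Abs_fps (\<lambda>i. 1 / of_nat (Suc i))"

lemma neg_log_quotient_nth [simp]: "neg_log_quotient $ i = 1 / of_nat (Suc i)"
  by (simp add: neg_log_quotient_def)

text \<open>The derivative of - log (1 - x) is 1 / (1 - x).\<close>

lemma neg_log_ODE: "(1 - fps_X) * fps_deriv (fps_X * neg_log_quotient) = 1"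
proof (rule fps_ext)
  fix n show "((1 - fps_X) * fps_deriv (fps_X * neg_log_quotient)) $ n = 1 $ n"
    by (cases n) (simp_all add: left_diff_distrib del: of_nat_Suc fps_deriv_mult)
qed

text \<open>With L = - log (1 - x), the differential equation gives (1 - x) (L ^ (m + 1))' = (m + 1)
  L ^ m. Its coefficients, scaled by factorials, obey the Stirling recurrence, whence an inner
  induction on \<open>n\<close> inside the one on \<open>m\<close>.\<close>

lemma stirling_eq_neg_log_power_nth:
  "of_nat (stirling n m) * fact m = fact n * (((fps_X * neg_log_quotient) ^ m) $ n)"
proof (induction m arbitrary: n)
  case 0
  then show ?case by (cases n) auto
next
  case (Suc m)
  note IH = this
  define L where "L = fps_X * neg_log_quotient"
  have ode: "(1 - fps_X) * fps_deriv (L ^ Suc m) = of_nat (Suc m) * L ^ m"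
  proof -
    have "(1 - fps_X) * fps_deriv (L ^ Suc m) = of_nat (Suc m) * ((1 - fps_X) * fps_deriv L) * L ^ m"
      by (subst fps_deriv_power') (simp add: algebra_simps)
    also have "(1 - fps_X) * fps_deriv L = 1"
      unfolding L_def by (rule neg_log_ODE)
    finally show ?thesis by simp
  qed
  have rec: "of_nat (Suc n) * (L ^ Suc m) $ Suc n
      = of_nat n * (L ^ Suc m) $ n + of_nat (Suc m) * (L ^ m) $ n" for n
  proof -
    have "((1 - fps_X) * fps_deriv (L ^ Suc m)) $ n = (of_nat (Suc m) * L ^ m) $ n"
      by (simp only: ode)
    then show ?thesis
      by (cases n) (simp_all add: left_diff_distrib fps_of_nat [symmetric] algebra_simps
          del: of_nat_Suc fps_deriv_mult fps_of_nat power_Suc)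
  qed
  show ?case unfolding L_def [symmetric]
  proof (induction n)
    case 0
    then show ?case by (simp add: L_def)
  next
    case (Suc n)
    have "of_nat (stirling (Suc n) (Suc m)) * (fact (Suc m) :: rat)
        = of_nat n * (of_nat (stirling n (Suc m)) * fact (Suc m))
          + of_nat (Suc m) * (of_nat (stirling n m) * fact m)"
      by (simp add: algebra_simps)
    also have "\<dots> = fact n * (of_nat n * (L ^ Suc m) $ n + of_nat (Suc m) * (L ^ m) $ n)"
      using IH[of n] Suc by (simp only: L_def) (simp add: algebra_simps)
    also have "\<dots> = fact (Suc n) * (L ^ Suc m) $ Suc n"
      unfolding rec [symmetric] by (simp add: algebra_simps)
    finally show ?case .
  qed
qed

lemma neg_log_power_nth:
  "((fps_X * neg_log_quotient) ^ m) $ n = (if n < m then 0 else (neg_log_quotient ^ m) $ (n - m))"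
  by (simp add: power_mult_distrib fps_X_power_mult_nth)

lemma stirling_eq_neg_log_quotient_nth:
  "of_nat (stirling (m + j) m) * fact m = fact (m + j) * ((neg_log_quotient ^ m) $ j)"
  by (simp add: stirling_eq_neg_log_power_nth neg_log_power_nth)

text \<open>In the Stirling recurrence one term carries the old partial sum to the next factorial,
  and the other contributes exactly the new coefficient.\<close>

lemma stirling_Suc_eq_sum_neg_log_quotient_nth:
  "of_nat (stirling (Suc (m + j)) (Suc m)) * fact m
    = fact (m + j) * (\<Sum>i\<le>j. (neg_log_quotient ^ m) $ i)"
proof (induction j)
  case 0
  then show ?case by (simp add: fps_nth_power_0)
next
  case (Suc j)
  have "of_nat (stirling (Suc (m + Suc j)) (Suc m)) * (fact m :: rat)
    = of_nat (m + Suc j) * (of_nat (stirling (Suc (m + j)) (Suc m)) * fact m)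
      + of_nat (stirling (m + Suc j) m) * fact m"
    by (simp add: algebra_simps)
  then show ?case unfolding Suc.IH stirling_eq_neg_log_quotient_nth
    by (simp add: algebra_simps)
qed

section \<open>Arithmetic in the localization at p\<close>

lemma p_integral_of_nat [simp]: "prime p \<Longrightarrow> p_integral p (of_nat x)"
  unfolding p_integral_def by (intro exI[of _ 1]) (auto simp: prime_nat_iff)

lemma p_integral_0 [simp]: "prime p \<Longrightarrow> p_integral p 0"
  using p_integral_of_nat[of p 0] by simp

lemma p_integral_add:
  assumes "prime p" "p_integral p x" "p_integral p y"
  shows "p_integral p (x + y)"
proof -
  obtain b c where b: "\<not> p dvd b" "of_nat b * x \<in> \<int>" and c: "\<not> p dvd c" "of_nat c * y \<in> \<int>"
    using assms by (auto simp: p_integral_def)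
  have "of_nat (b * c) * (x + y) = of_nat c * (of_nat b * x) + of_nat b * (of_nat c * y)"
    by (simp add: algebra_simps)
  also have "\<dots> \<in> \<int>" using b c by simp
  finally show ?thesis
    using b c assms(1) by (auto simp: p_integral_def prime_dvd_mult_iff intro!: exI[of _ "b * c"])
qed

lemma p_integral_mult:
  assumes "prime p" "p_integral p x" "p_integral p y"
  shows "p_integral p (x * y)"
proof -
  obtain b c where b: "\<not> p dvd b" "of_nat b * x \<in> \<int>" and c: "\<not> p dvd c" "of_nat c * y \<in> \<int>"
    using assms by (auto simp: p_integral_def)
  have "of_nat (b * c) * (x * y) = (of_nat b * x) * (of_nat c * y)"
    by (simp add: algebra_simps)
  also have "\<dots> \<in> \<int>" using b c by simp
  finally show ?thesis
    using b c assms(1) by (auto simp: p_integral_def prime_dvd_mult_iff intro!: exI[of _ "b * c"])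
qed

lemma p_integral_sum:
  assumes "prime p" "\<And>i. i \<in> A \<Longrightarrow> p_integral p (f i)"
  shows "p_integral p (sum f A)"
  using assms by (induction A rule: infinite_finite_induct) (auto intro: p_integral_add)

lemma p_divisible_0 [simp]: "prime p \<Longrightarrow> p_divisible p 0"
  by (simp add: p_divisible_def)

lemma p_divisible_add:
  "prime p \<Longrightarrow> p_divisible p x \<Longrightarrow> p_divisible p y \<Longrightarrow> p_divisible p (x + y)"
  by (simp add: p_divisible_def add_divide_distrib p_integral_add)

lemma p_divisible_sum:
  assumes "prime p" "\<And>i. i \<in> A \<Longrightarrow> p_divisible p (f i)"
  shows "p_divisible p (sum f A)"
  using assms by (simp add: p_divisible_def sum_divide_distrib p_integral_sum)

lemma p_divisible_mult:
  "prime p \<Longrightarrow> p_divisible p x \<Longrightarrow> p_integral p y \<Longrightarrow> p_divisible p (x * y)"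
  using p_integral_mult[of p "x / of_nat p" y] by (simp add: p_divisible_def)

lemma p_divisible_power:
  assumes "prime p" "0 < e" shows "p_divisible p (of_nat p ^ e)"
proof -
  have "of_nat p ^ e / of_nat p = (of_nat (p ^ (e - 1)) :: rat)"
    using assms by (cases e) (auto simp: prime_gt_0_nat)
  then show ?thesis using assms by (simp add: p_divisible_def del: of_nat_power)
qed

lemma p_integral_power_over:
  assumes "prime p" "0 < n" "multiplicity p n \<le> t"
  shows "p_integral p (of_nat p ^ t / of_nat n)"
proof -
  define e where "e = multiplicity p n"
  obtain u where u: "n = p ^ e * u" "\<not> p dvd u"
    using multiplicity_decompose'[of n p] assms by (auto simp: e_def prime_nat_iff)
  have "u \<noteq> 0" using u(2) by (metis dvd_0_right)
  have "of_nat p ^ t = (of_nat p ^ e * of_nat p ^ (t - e) :: rat)"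
    using assms(3) by (simp add: e_def flip: power_add)
  moreover have "of_nat n = (of_nat p ^ e * of_nat u :: rat)"
    using arg_cong[OF u(1), of of_nat] by simp
  ultimately have "of_nat u * (of_nat p ^ t / of_nat n) = (of_nat (p ^ (t - e)) :: rat)"
    using \<open>u \<noteq> 0\<close> prime_gt_0_nat[OF assms(1)] by simp
  then have "of_nat u * (of_nat p ^ t / of_nat n :: rat) \<in> \<int>" by (simp only: Ints_of_nat)
  with u(2) show ?thesis unfolding p_integral_def by blast
qed

lemma p_divisible_power_over:
  assumes "prime p" "0 < n" "multiplicity p n < t"
  shows "p_divisible p (of_nat p ^ t / of_nat n)"
proof -
  have "p_integral p (of_nat p ^ (t - 1) / of_nat n)"
    using assms by (intro p_integral_power_over) auto
  moreover have "of_nat p ^ (t - 1) / of_nat n = (of_nat p ^ t / of_nat n / of_nat p :: rat)"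
    using assms by (cases t) (auto simp: prime_gt_0_nat)
  ultimately show ?thesis by (simp add: p_divisible_def)
qed

section \<open>Valuations of the denominators of the series\<close>

text \<open>Bernoulli's inequality for the base 1 + (p - 1).\<close>

lemma Suc_mult_le_power: "1 \<le> p \<Longrightarrow> v * (p - 1) + 1 \<le> (p::nat) ^ v"
proof (induction v)
  case (Suc v)
  have "Suc v * (p - 1) + 1 \<le> p ^ v + (p - 1) * p ^ v"
    using Suc by (intro order.trans[OF _ add_mono[OF Suc.IH mult_left_mono[of 1]]]) auto
  then show ?case using Suc.prems by (cases p) auto
qed simp

text \<open>Bernoulli's inequality is an equality for exponents 0 and 1 and strict from 2 on. This
  is why just two coefficients of the scaled series survive modulo \<open>p\<close>.\<close>

lemma Suc_mult_less_power:
  assumes "2 \<le> p" "2 \<le> v" shows "v * (p - 1) + 1 < (p::nat) ^ v"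
proof -
  obtain w where v: "v = Suc w" "1 \<le> w" using assms by (cases v) auto
  have "p ^ 1 \<le> p ^ w" using assms v by (intro power_increasing) auto
  then have "(p - 1) * 1 < (p - 1) * p ^ w" using assms by (intro mult_strict_left_mono) auto
  moreover have "w * (p - 1) + 1 \<le> p ^ w" using assms by (intro Suc_mult_le_power) simp
  moreover have "p ^ v = p ^ w + (p - 1) * p ^ w" using assms v by (cases p) auto
  moreover have "v * (p - 1) + 1 = (w * (p - 1) + 1) + (p - 1) * 1" using v by simp
  ultimately show ?thesis by linarith
qed

lemma multiplicity_Suc_le_div:
  assumes "prime p" shows "multiplicity p (Suc i) \<le> i div (p - 1)"
proof -
  have "p ^ multiplicity p (Suc i) \<le> Suc i"
    by (intro dvd_imp_le multiplicity_dvd) auto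
  moreover have "multiplicity p (Suc i) * (p - 1) + 1 \<le> p ^ multiplicity p (Suc i)"
    using prime_ge_1_nat[OF assms] by (rule Suc_mult_le_power)
  ultimately show ?thesis
    using prime_gt_1_nat[OF assms] by (simp add: less_eq_div_iff_mult_less_eq)
qed

text \<open>Equality would give p ^ t <= 1 + t (p - 1), against the strict Bernoulli inequality. At
  t = 1 the number is \<open>p\<close> itself and equality does occur.\<close>

lemma multiplicity_Suc_less:
  assumes "prime p" "2 \<le> t" shows "multiplicity p (Suc (t * (p - 1))) < t"
proof -
  have "multiplicity p (Suc (t * (p - 1))) \<le> t"
    using multiplicity_Suc_le_div[OF assms(1), of "t * (p - 1)"] prime_gt_1_nat[OF assms(1)] by simp
  moreover have "multiplicity p (Suc (t * (p - 1))) \<noteq> t"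
  proof
    assume "multiplicity p (Suc (t * (p - 1))) = t"
    then have "p ^ t \<le> Suc (t * (p - 1))"
      using multiplicity_dvd[of p "Suc (t * (p - 1))"] by (metis dvd_imp_le zero_less_Suc)
    with Suc_mult_less_power[of p t] assms prime_ge_2_nat[of p] show False by simp
  qed
  ultimately show ?thesis by simp
qed

section \<open>Coefficients of the powers modulo p\<close>

lemma div_add_le: "a div d + b div d \<le> (a + b) div (d::nat)"
  by (subst div_add1_eq) simp

text \<open>
  For a root \<open>\<pi>\<close> of \<open>\<pi> ^ (p - 1) = p\<close>, the series \<^const>\<open>neg_log_quotient\<close> evaluated at \<open>\<pi> x\<close>
  is integral and congruent to \<open>1 + x ^ (p - 1)\<close> modulo \<open>\<pi>\<close>; the lemma is the \<open>m\<close>-th power of this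
  congruence, stated without adjoining \<open>\<pi>\<close>.
\<close>

lemma neg_log_quotient_power_nth:
  assumes p: "prime p"
  shows "p_integral p (of_nat p ^ (j div (p - 1)) * (neg_log_quotient ^ m) $ j)"
    and "p_divisible p (of_nat p ^ r * (neg_log_quotient ^ m) $ (r * (p - 1)) - of_nat (m choose r))"
proof (induction m arbitrary: j r)
  case 0
  have d: "p - 1 > 0" using prime_gt_1_nat[OF p] by simp
  {
    case (1 j)
    then show ?case using p_integral_of_nat[OF p, of 1] p by (cases j) auto
  next
    case (2 r)
    then show ?case using p d by (cases r) auto
  }
next
  case (Suc m)
  define d where "d = p - 1"
  have d: "d > 0" using prime_gt_1_nat[OF p] by (simp add: d_def)
  define B where "B j = of_nat p ^ (j div d) * (neg_log_quotient ^ m) $ j" for j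
  define A where "A i = of_nat p ^ (i div d) / (of_nat (Suc i) :: rat)" for i
  define T where "T j i = of_nat p ^ (j div d) * (neg_log_quotient $ i * (neg_log_quotient ^ m) $ (j - i))" for j i
  have B: "p_integral p (B j)" for j using Suc.IH(1) by (simp add: B_def d_def)
  have B_choose: "p_divisible p (of_nat p ^ r * (neg_log_quotient ^ m) $ (r * d) - of_nat (m choose r))" for r
    using Suc.IH(2) by (simp add: d_def)
  have A: "p_integral p (A i)" for i
    unfolding A_def d_def by (intro p_integral_power_over p multiplicity_Suc_le_div) auto
  \<comment> \<open>Each convolution term is a product of the integral factors \<open>A i\<close>
    and \<open>B (j - i)\<close> and a spare power of \<open>p\<close>, whose exponent is
    nonnegative by superadditivity of the floor.\<close>
  have T: "T j i = of_nat p ^ (j div d - (i div d + (j - i) div d)) * (A i * B (j - i))"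
    if "i \<le> j" for i j
  proof -
    have "i div d + (j - i) div d \<le> j div d" using div_add_le[of i d "j - i"] that by simp
    then have "of_nat p ^ (j div d) = (of_nat p ^ (j div d - (i div d + (j - i) div d))
        * (of_nat p ^ (i div d) * of_nat p ^ ((j - i) div d)) :: rat)"
      by (simp flip: power_add)
    then show ?thesis by (simp add: T_def A_def B_def)
  qed
  have sum: "of_nat p ^ (j div d) * (neg_log_quotient ^ Suc m) $ j = (\<Sum>i=0..j. T j i)" for j
    by (simp add: fps_mult_nth sum_distrib_left T_def)
  {
    case (1 j)
    have "p_integral p (T j i)" if "i \<le> j" for i
      unfolding T[OF that] of_nat_power [symmetric] by (intro p_integral_mult p_integral_of_nat p A B)
    then show ?case unfolding d_def [symmetric] sum by (intro p_integral_sum p) auto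
  next
    case (2 r)
    show ?case
    proof (cases r)
      case 0
      then show ?thesis using p by (simp add: fps_nth_power_0)
    next
      case (Suc s)
      define j where "j = r * d"
      have jd: "j div d = r" using d by (simp add: j_def)
      \<comment> \<open>The indices 0 and \<open>d\<close> give the terms \<open>m choose r\<close>
        and \<open>m choose s\<close> of Pascal's rule; all others vanish modulo
        \<open>p\<close>.\<close>
      have T0: "T j 0 = of_nat p ^ r * (neg_log_quotient ^ m) $ (r * d)"
        by (simp add: T_def jd) (simp add: j_def)
      have "T j d = A d * B (s * d)"
        using d by (subst T) (auto simp: j_def Suc)
      moreover have "A d = 1" using d prime_gt_0_nat[OF p]
        by (simp add: A_def) (simp add: d_def of_nat_diff)
      ultimately have T1: "T j d = of_nat p ^ s * (neg_log_quotient ^ m) $ (s * d)"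
        using d by (simp add: B_def)
      \<comment> \<open>If i = t d, then t >= 2 and \<open>A i\<close> is divisible by
        \<open>p\<close>; if \<open>d\<close> does not divide \<open>i\<close>, the spare power of
        \<open>p\<close> is nontrivial.\<close>
      have rest: "p_divisible p (T j i)" if i: "i \<le> j" "i \<noteq> 0" "i \<noteq> d" for i
      proof (cases "d dvd i")
        case True
        then obtain t where t: "i = t * d" by (metis dvd_def mult.commute)
        have "t \<noteq> 0" "t \<noteq> 1" using i t by auto
        then have "2 \<le> t" by simp
        then have "multiplicity p (Suc i) < i div d"
          using multiplicity_Suc_less[OF p, of t] d by (simp add: t d_def)
        then have "p_divisible p (A i)"
          unfolding A_def by (intro p_divisible_power_over p) auto
        then show ?thesis unfolding T[OF i(1)] of_nat_power [symmetric]
          by (subst mult.commute) (intro p_divisible_mult p p_integral_of_nat B)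
      next
        case False
        \<comment> \<open>Rounding \<open>i / d\<close> down loses something, while
          \<open>j / d\<close> is the integer \<open>r\<close>.\<close>
        have "i div d + (j - i) div d < r"
        proof -
          have "i div d * d + i mod d = i" "i mod d \<noteq> 0"
            using False by (simp_all add: dvd_eq_mod_eq_0)
          then have "i div d * d < i" by linarith
          have "(i div d + (j - i) div d) * d = i div d * d + (j - i) div d * d"
            by (simp add: algebra_simps)
          also have "\<dots> < i + (j - i)"
            using \<open>i div d * d < i\<close> by (intro add_less_le_mono) simp_all
          also have "\<dots> = r * d" using i(1) by (simp add: j_def)
          finally show ?thesis by simp
        qed
        then show ?thesis unfolding T[OF i(1)] jd
          by (intro p_divisible_mult p p_divisible_power p_integral_mult A B) auto
      qed
      have "{0..j} = {0, d} \<union> ({0..j} - {0, d})" using d by (auto simp: j_def Suc)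
      then have "(\<Sum>i=0..j. T j i) = (\<Sum>i\<in>{0, d}. T j i) + (\<Sum>i\<in>{0..j} - {0, d}. T j i)"
        by (metis finite_atLeastAtMost le_sup_iff order_refl sum.subset_diff add.commute)
      then have "of_nat p ^ r * (neg_log_quotient ^ Suc m) $ (r * d) - of_nat (Suc m choose r)
        = (of_nat p ^ r * (neg_log_quotient ^ m) $ (r * d) - of_nat (m choose r))
          + (of_nat p ^ s * (neg_log_quotient ^ m) $ (s * d) - of_nat (m choose s))
          + (\<Sum>i\<in>{0..j} - {0, d}. T j i)"
        using sum[of j] d by (simp add: jd T0 T1) (simp add: j_def Suc algebra_simps)
      also have "p_divisible p \<dots>"
        by (intro p_divisible_add p p_divisible_sum B_choose) (auto intro: rest)
      finally show ?thesis by (simp only: d_def)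
    qed
  }
qed

text \<open>A coefficient before the last needs a power of \<open>p\<close> below \<open>r\<close>
  to become integral, so the factor p ^ r makes it divisible by \<open>p\<close>; only the last one
  contributes a residue.\<close>

lemma neg_log_quotient_power_partial_sum:
  assumes p: "prime p"
  shows "p_divisible p (of_nat p ^ r * (\<Sum>i\<le>r * (p - 1). (neg_log_quotient ^ m) $ i) - of_nat (m choose r))"
proof -
  define d where "d = p - 1"
  have d: "d > 0" using prime_gt_1_nat[OF p] by (simp add: d_def)
  have "p_divisible p (of_nat p ^ r * (neg_log_quotient ^ m) $ i)" if "i < r * d" for i
  proof -
    have lt: "i div d < r" using that by (simp add: less_mult_imp_div_less)
    then have "of_nat p ^ r * (neg_log_quotient ^ m) $ i
      = of_nat p ^ (r - i div d) * (of_nat p ^ (i div d) * (neg_log_quotient ^ m) $ i)"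
      by (simp flip: power_add mult.assoc)
    also have "p_divisible p \<dots>" using lt unfolding d_def
      by (intro p_divisible_mult p_divisible_power neg_log_quotient_power_nth p) auto
    finally show ?thesis .
  qed
  then have "p_divisible p (\<Sum>i<r * d. of_nat p ^ r * (neg_log_quotient ^ m) $ i)"
    by (intro p_divisible_sum p) auto
  moreover have "p_divisible p (of_nat p ^ r * (neg_log_quotient ^ m) $ (r * d) - of_nat (m choose r))"
    using neg_log_quotient_power_nth(2)[OF p] by (simp add: d_def)
  ultimately have "p_divisible p ((\<Sum>i<r * d. of_nat p ^ r * (neg_log_quotient ^ m) $ i)
      + (of_nat p ^ r * (neg_log_quotient ^ m) $ (r * d) - of_nat (m choose r)))"
    by (intro p_divisible_add p)
  then show ?thesis
    unfolding d_def [symmetric]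
    by (simp flip: lessThan_Suc_atMost add: sum_distrib_left algebra_simps)
qed

section \<open>From a congruence to a valuation\<close>

lemma multiplicity_int: "multiplicity (int p) (int x) = multiplicity p x"
  by (simp add: multiplicity_def flip: of_nat_power)

text \<open>The congruence says that \<open>g\<close> has valuation exactly \<open>- r\<close>.
  Clearing the denominator \<open>b\<close> yields b p ^ r x = (b c + p z) y with \<open>b\<close>
  and the bracket prime to \<open>p\<close>. The valuations are compared over the integers, since
  \<open>z\<close> may be negative.\<close>

lemma multiplicity_eq_if_p_divisible_diff:
  assumes p: "prime p" and "y \<noteq> 0"
    and eq: "of_nat x = of_nat y * (g :: rat)"
    and g: "p_divisible p (of_nat p ^ r * g - of_nat c)" and c: "\<not> p dvd c"
  shows "x \<noteq> 0 \<and> multiplicity p x + r = multiplicity p y"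
proof -
  obtain b where b: "\<not> p dvd b" "of_nat b * ((of_nat p ^ r * g - of_nat c) / of_nat p) \<in> \<int>"
    using g by (auto simp: p_divisible_def p_integral_def)
  then obtain z where z: "of_nat b * ((of_nat p ^ r * g - of_nat c) / of_nat p) = of_int z"
    by (auto elim: Ints_cases)
  have "of_nat b * (of_nat p ^ r * g - of_nat c) = of_int z * of_nat p"
    using z prime_gt_0_nat[OF p] by (simp add: field_simps)
  then have bg: "of_nat b * of_nat p ^ r * g = of_int (int b * int c + int p * z)"
    by (simp add: algebra_simps)
  have "of_int (int b * (int p ^ r * int x)) = of_nat y * (of_nat b * of_nat p ^ r * g)"
    using eq by simp
  also have "\<dots> = of_int (int y * (int b * int c + int p * z))" by (simp add: bg)
  finally have E: "int b * (int p ^ r * int x) = (int b * int c + int p * z) * int y"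
    by (simp only: of_int_eq_iff mult.commute)
  have pe: "prime_elem (int p)" using p by simp
  have "\<not> int p dvd int (b * c)" using b c p by (simp only: int_dvd_int_iff prime_dvd_mult_iff) simp
  then have u: "\<not> int p dvd int b * int c + int p * z" by (simp add: dvd_add_left_iff)
  have x: "x \<noteq> 0" 
  proof
    assume "x = 0"
    then have "int b * int c + int p * z = 0" using E \<open>y \<noteq> 0\<close> by simp
    with u show False by simp
  qed
  have "multiplicity (int p) (int b * (int p ^ r * int x)) = r + multiplicity (int p) (int x)"
    using b x assms pe prime_gt_1_nat[OF p]
    by (simp add: multiplicity_prime_elem_times_other prime_elem_multiplicity_mult_distrib
        multiplicity_same_power)
  moreover have "multiplicity (int p) ((int b * int c + int p * z) * int y) = multiplicity (int p) (int y)"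
    using multiplicity_prime_elem_times_other[OF pe u] .
  ultimately show ?thesis using E x by (simp add: multiplicity_int)
qed

section \<open>Digit sums and Legendre's formula\<close>

lemma digit_sum_0 [simp]: "digit_sum p 0 = 0"
  by (simp add: digit_sum_def)

text \<open>Digits at positions beyond \<open>m\<close> vanish, so numbers of different size can
  share one summation range.\<close>

lemma digit_sum_eq_sum_upto:
  assumes "2 \<le> p" "m \<le> N"
  shows "digit_sum p m = (\<Sum>i\<le>N. m div p ^ i mod p)"
  unfolding digit_sum_def
proof (rule sum.mono_neutral_left)
  show "\<forall>i\<in>{..N} - {..m}. m div p ^ i mod p = 0"
  proof
    fix i assume "i \<in> {..N} - {..m}"
    then have "m < i" by simp
    also have "i < p ^ i" using assms by (intro power_gt_expt) auto
    finally show "m div p ^ i mod p = 0" by simp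
  qed
qed (use assms in auto)

lemma digit_sum_rec:
  assumes "2 \<le> p" shows "digit_sum p m = m mod p + digit_sum p (m div p)"
proof -
  have "digit_sum p m = (\<Sum>i\<le>Suc m. m div p ^ i mod p)"
    using assms by (intro digit_sum_eq_sum_upto) auto
  also have "\<dots> = m mod p + (\<Sum>i\<le>m. m div p div p ^ i mod p)"
    by (subst sum.atMost_Suc_shift) (simp add: div_mult2_eq)
  also have "(\<Sum>i\<le>m. m div p div p ^ i mod p) = digit_sum p (m div p)"
    using assms by (intro digit_sum_eq_sum_upto [symmetric]) auto
  finally show ?thesis .
qed

text \<open>Adding 1 turns every trailing digit p - 1 into 0. Each such carry costs p - 1, and the
  number of carries is the number of trailing zeros of \<open>Suc m\<close>, that is, its
  valuation.\<close>

lemma digit_sum_Suc: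
  assumes p: "prime p"
  shows "digit_sum p (Suc m) + (p - 1) * multiplicity p (Suc m) = digit_sum p m + 1"
proof (induction m rule: less_induct)
  case (less m)
  have p2: "2 \<le> p" using prime_ge_2_nat[OF p] .
  show ?case
  proof (cases "p dvd Suc m")
    case False
    then have "Suc m mod p = Suc (m mod p)" "Suc m div p = m div p"
      by (auto simp: mod_Suc div_Suc dvd_eq_mod_eq_0)
    then show ?thesis
      using False digit_sum_rec[OF p2, of m] digit_sum_rec[OF p2, of "Suc m"]
      by (simp add: not_dvd_imp_multiplicity_0)
  next
    case True
    then obtain t where "Suc m = p * t" by (auto simp: dvd_def)
    then obtain s where s: "Suc m = p * Suc s" by (cases t) auto
    then have m: "m = (p - 1) + p * s" using p2 by (simp add: algebra_simps)
    have "m mod p = p - 1" "m div p = s" unfolding m using p2 by (simp_all del: add_diff_assoc2)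
    then have "digit_sum p m = p - 1 + digit_sum p s" using digit_sum_rec[OF p2, of m] by simp
    moreover have "digit_sum p (Suc m) = digit_sum p (Suc s)"
      unfolding s using digit_sum_rec[OF p2, of "p * Suc s"] p2 by simp
    moreover have "multiplicity p (Suc m) = Suc (multiplicity p (Suc s))"
      unfolding s using p2 p by (intro multiplicity_times_same) auto
    moreover have "s < m"
    proof -
      have "1 * s \<le> p * s" using p2 by (intro mult_right_mono) auto
      then show ?thesis using m p2 by linarith
    qed
    ultimately show ?thesis using less.IH[of s] by simp
  qed
qed

text \<open>Legendre's formula, obtained by telescoping \<open>digit_sum_Suc\<close> over the
  factors of the factorial.\<close>

lemma legendre_digit_sum:
  assumes p: "prime p"
  shows "(p - 1) * multiplicity p (fact m) + digit_sum p m = m"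
proof (induction m)
  case (Suc m)
  have "multiplicity p (fact (Suc m) :: nat) = multiplicity p (Suc m) + multiplicity p (fact m :: nat)"
    unfolding fact_Suc of_nat_id
    using p by (intro prime_elem_multiplicity_mult_distrib) auto
  then show ?case using Suc digit_sum_Suc[OF p, of m] by (simp add: algebra_simps)
qed simp

section \<open>Binomial coefficients prime to p\<close>

text \<open>Write i = p ^ e u with \<open>u\<close> prime to \<open>p\<close>; the bound on
  \<open>i\<close> forces e <= h. After division by p ^ e the difference is congruent to
  \<open>- u\<close> modulo \<open>p\<close> if e < h, and equals a - u, strictly between 0 and
  \<open>p\<close>, if e = h.\<close>

lemma multiplicity_diff_mult_power:
  fixes p a i h :: nat
  assumes p: "prime p" and "a < p" "0 < i" "i < a * p ^ h"
  shows "multiplicity p (a * p ^ h - i) = multiplicity p i"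
proof -
  define e where "e = multiplicity p i"
  obtain u where u: "i = p ^ e * u" "\<not> p dvd u"
    using multiplicity_decompose'[of i p] assms(1,3) by (auto simp: e_def prime_nat_iff)
  have "p ^ e \<le> i" using assms u(1) by (intro dvd_imp_le) auto
  also have "i < p ^ Suc h"
    using assms(2,4) by (metis less_imp_le less_le_trans mult_le_mono1 power_Suc)
  finally have "p ^ e < p ^ Suc h" .
  then have "e \<le> h" using power_less_imp_less_exp[OF prime_gt_1_nat[OF p], of e "Suc h"] by simp
  then have split: "a * p ^ h = p ^ e * (a * p ^ (h - e))" by (simp flip: power_add)
  then have eq: "a * p ^ h - i = p ^ e * (a * p ^ (h - e) - u)"
    by (simp only: diff_mult_distrib2 split flip: u(1))
  have ua: "u < a * p ^ (h - e)"
    using assms(4) eq by (metis mult_0_right not_le diff_is_0_eq zero_less_diff)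
  have "\<not> p dvd a * p ^ (h - e) - u"
  proof (cases "e = h")
    case True
    then show ?thesis using ua assms by (auto dest!: dvd_imp_le)
  next
    case False
    then have "p dvd a * p ^ (h - e)" using \<open>e \<le> h\<close> by simp
    then show ?thesis using u(2) ua by (metis dvd_diffD1 less_imp_le)
  qed
  then show ?thesis unfolding eq
    using p prime_gt_1_nat[OF p]
    by (subst mult.commute) (simp add: multiplicity_prime_elem_times_other multiplicity_same_power e_def)
qed

text \<open>Passing from \<open>r\<close> to \<open>r + 1\<close> multiplies the binomial
  coefficient by (a p ^ h - (r + 1)) / (r + 1), where numerator and denominator have equal
  valuation.\<close>

lemma not_dvd_binomial_mult_power_minus_1:
  assumes p: "prime p" and a: "a < p" and "r < a * p ^ h"
  shows "\<not> p dvd (a * p ^ h - 1 choose r)"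
  using assms(3)
proof (induction r)
  case 0
  then show ?case using p by (auto simp: prime_nat_iff)
next
  case (Suc r)
  define K where "K = a * p ^ h - 1"
  have lt: "r < K" using Suc.prems by (simp add: K_def)
  have pe: "prime_elem p" using p by simp
  have eq: "Suc r * (K choose Suc r) = (K - r) * (K choose r)"
    by (metis binomial_absorb_comp binomial_absorption)
  have "multiplicity p (Suc r) + multiplicity p (K choose Suc r)
      = multiplicity p (K - r) + multiplicity p (K choose r)"
    using arg_cong[OF eq, of "multiplicity p"] lt pe
    by (simp add: prime_elem_multiplicity_mult_distrib del: mult_Suc binomial_Suc_Suc)
  moreover have "multiplicity p (K - r) = multiplicity p (Suc r)"
    using multiplicity_diff_mult_power[OF p a _ Suc.prems] by (simp add: K_def)
  moreover have "multiplicity p (K choose r) = 0"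
    using Suc by (intro not_dvd_imp_multiplicity_0) (simp add: K_def)
  ultimately have "multiplicity p (K choose Suc r) = 0" by simp
  moreover have "K choose Suc r \<noteq> 0" using lt by simp
  ultimately show ?case
    using pe prime_multiplicity_gt_zero_iff[of p "K choose Suc r"] unfolding K_def by linarith
qed

section \<open>Valuations of the two Stirling numbers\<close>

theorem theorem4p3:
  fixes p h a k n :: nat
  assumes "prime p"
    and "1 \<le> a" and "a \<le> p - 1"
    and "k = a * p ^ h"
    and "(int p - 1) dvd (int n - int a)"
    and "k \<le> n" and "n < k * p"
  shows "minimum_zero_case p n k \<and>
    shifted_minimum_zero_case p (n - 1) (k - 1) \<and>
    multiplicity p (stirling n k) = multiplicity p (stirling (n - 1) (k - 1)) \<and>
    real (multiplicity p (stirling (n - 1) (k - 1)))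
      = (real (digit_sum p (k - 1)) - real (digit_sum p (n - 1))) / (real p - 1)"
proof -
  note p = assms(1)
  have p2: "2 \<le> p" using prime_ge_2_nat[OF p] .
  define d where "d = p - 1"
  have d: "d > 0" "int d = int p - 1" using p2 by (auto simp: d_def)
  have k: "0 < k" using assms(2,4) p2 by simp
  \<comment> \<open>Since p - 1 divides p ^ h - 1, \<open>k\<close> is congruent to
    \<open>a\<close>, hence to \<open>n\<close>, modulo p - 1.\<close>
  have "int d dvd int a * int p ^ h - int a"
  proof -
    have "int d dvd int p ^ h - 1" by (simp add: d power_diff_1_eq)
    then have "int d dvd int a * (int p ^ h - 1)" by simp
    then show ?thesis by (simp add: algebra_simps)
  qed
  with assms(5) have "int d dvd (int n - int a) - (int a * int p ^ h - int a)"
    unfolding d by (rule dvd_diff)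
  then have "int d dvd int (n - k)" using assms(6) by (simp add: assms(4) of_nat_diff)
  then have "d dvd n - k" by (simp only: int_dvd_int_iff)
  then obtain r where r: "n - k = r * d" by (metis dvd_def mult.commute)
  \<comment> \<open>The bound n < k p amounts to n - k < k (p - 1), which puts \<open>r\<close> in
    the range where the binomial coefficient is prime to \<open>p\<close>.\<close>
  have "r * d < k * d" using r assms(6,7) p2 by (auto simp: d_def algebra_simps diff_mult_distrib2)
  then have rk: "r < k" by simp
  \<comment> \<open>With this shift both Stirling numbers are expressed through the same factorials
    of \<open>K\<close> and \<open>K + r * d\<close>.\<close>
  define K where "K = k - 1"
  have kK: "k = Suc K" and nK: "n = Suc (K + r * d)" using k r assms(6) by (auto simp: K_def)
  have c: "\<not> p dvd (K choose r)"
    using not_dvd_binomial_mult_power_minus_1[OF p, of a r h] rk assms(3,4) p2 by (simp add: K_def)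
  \<comment> \<open>The valuation depends only on the residue of p ^ r g. The last coefficient and
    the partial sum share this residue, so both Stirling numbers get the same valuation.\<close>
  have val: "s \<noteq> 0 \<and> multiplicity p s + multiplicity p (fact K :: nat) + r
      = multiplicity p (fact (K + r * d) :: nat)"
    if eq: "of_nat s * fact K = fact (K + r * d) * (g :: rat)"
      and g: "p_divisible p (of_nat p ^ r * g - of_nat (K choose r))" for s g
  proof -
    have "s * fact K \<noteq> 0 \<and> multiplicity p (s * fact K) + r = multiplicity p (fact (K + r * d) :: nat)"
      using eq g c p by (intro multiplicity_eq_if_p_divisible_diff[where g = g]) auto
    then show ?thesis
      using p prime_elem_multiplicity_mult_distrib[of p s "fact K"] by (simp del: of_nat_fact)
  qed
  have 1: "stirling n k \<noteq> 0 \<and> multiplicity p (stirling n k) + multiplicity p (fact K :: nat) + r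
      = multiplicity p (fact (K + r * d) :: nat)"
    unfolding kK nK
    by (rule val[OF stirling_Suc_eq_sum_neg_log_quotient_nth])
      (use neg_log_quotient_power_partial_sum[OF p] in \<open>simp add: d_def\<close>)
  have 2: "stirling (n - 1) (k - 1) \<noteq> 0 \<and>
      multiplicity p (stirling (n - 1) (k - 1)) + multiplicity p (fact K :: nat) + r
      = multiplicity p (fact (K + r * d) :: nat)"
    unfolding kK nK diff_Suc_1
    by (rule val[OF stirling_eq_neg_log_quotient_nth])
      (use neg_log_quotient_power_nth(2)[OF p] in \<open>simp add: d_def\<close>)
  define v where "v = multiplicity p (stirling (n - 1) (k - 1))"
  \<comment> \<open>After multiplication by p - 1, Legendre's formula applies to both factorials;
    the linear terms \<open>K\<close>, \<open>r * d\<close> and \<open>K + r * d\<close> cancel and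
    leave the digit sums of k - 1 and n - 1.\<close>
  have "d * v + d * multiplicity p (fact K :: nat) + d * r = d * multiplicity p (fact (K + r * d) :: nat)"
    using 2 by (simp add: v_def flip: distrib_left)
  then have "d * v + digit_sum p (K + r * d) = digit_sum p K"
    using legendre_digit_sum[OF p, of K] legendre_digit_sum[OF p, of "K + r * d"]
    by (simp add: d_def algebra_simps)
  then have "real (d * v + digit_sum p (n - 1)) = real (digit_sum p (k - 1))"
    by (simp add: kK nK)
  moreover have "real d = real p - 1" using p2 by (simp add: d_def of_nat_diff)
  ultimately have "real v = (real (digit_sum p (k - 1)) - real (digit_sum p (n - 1))) / (real p - 1)"
    using d(1) by (simp add: field_simps)
  then show ?thesis
    using 1 2 k by (simp add: minimum_zero_case_def shifted_minimum_zero_case_def v_def)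
qed

end
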